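(* Let $N$ be a positive integer and let $\alpha,\beta,\zeta,\rho$ be real parameters that are generic (no denominator appearing in the formulas of the context or below vanishes). For $m,n\in\{0,\dots,N\}$ let $S_m(n)=\langle f_n^*|e_m\rangle$ and $\tilde S_m(n)=\langle f_n|e_m^*\rangle$, where $|e_m\rangle,|e_m^*\rangle,|f_n\rangle,|f_n^*\rangle\in\mathbb R^{N+1}$ are the vectors given in the context. Put $$\hat\alpha=-\beta-\rho-1,\qquad \hat\beta=-\beta+\rho-2\zeta-1,\qquad \hat\gamma=N-2\alpha-\rho .$$ Then for all $m,n\in\{0,\dots,N\}$ $$S_m(n)=\frac{(\hat\alpha+1)_n\,(-N,\hat\beta+\hat\gamma+1)_m}{n!\,(n-N+\hat\gamma)_n\,(m+\hat\alpha+\hat\beta+1)_m}\,R_m(n;\hat\alpha,\hat\beta,\hat\gamma,N),$$ $$\tilde S_m(n)=\frac{(-1)^N(-N,\hat\gamma-\hat\alpha-N,-\hat\beta-N)_{N-m}\,(\hat\alpha+1)_m\,(-\hat\gamma-\hat\beta-n)_n}{(-N-m-\hat\alpha-\hat\beta-1)_{N-m}\,(n-N,-\hat\gamma-n)_{N-n}\,(\hat\gamma-\hat\alpha-N,-N-\hat\beta)_n}\,R_m(n;\hat\alpha,\hat\beta,\hat\gamma,N),$$ where $R_m$ is the Racah polynomial defined in the context.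
   Context: Notation: $(a)_n=a(a+1)\cdots(a+n-1)$, $(a)_0=1$, and $(a_1,\dots,a_k)_n=(a_1)_n\cdots(a_k)_n$. The Racah polynomials are $$R_i(x;\hat\alpha,\hat\beta,\hat\gamma,N)={}_4F_3\left({-i,\ i+\hat\alpha+\hat\beta+1,\ -x,\ x+\hat\gamma-N\atop \hat\alpha+1,\ \hat\beta+\hat\gamma+1,\ -N};1\right),\quad i=0,\dots,N,$$ where for $i,x\in\{0,\dots,N\}$ the series is the finite sum over $\ell=0,\dots,\min(i,x)$. Let $|0\rangle,\dots,|N\rangle$ be the standard orthonormal basis of $\mathbb R^{N+1}$ and $\langle v|w\rangle$ the standard real scalar product. Consider the operators (with $|N+1\rangle=|-1\rangle=0$) $$Z|n\rangle=(n-\alpha)|n\rangle+|n+1\rangle,\qquad X|n\rangle=-(n-\alpha)^2|n\rangle-(n-\beta)|n+1\rangle,$$ $$V|n\rangle=(n-\beta-\zeta-1)(\beta+\zeta-n)|n\rangle+n(N+1-n)(n-1-2\alpha-\beta-2\zeta+N)|n-1\rangle .$$ The vectors $|e_n\rangle$, $|e_n^*\rangle$ are eigenvectors of $V$, $V^\top$ with eigenvalue $(n-\beta-\zeta-1)(\beta+\zeta-n)$, and $|f_n\rangle$, $|f_n^*\rangle$ are eigenvectors of $X+\rho Z$, $X^\top+\rho Z^\top$ with eigenvalue $(n-\alpha-\rho)(\alpha-n)$, normalized as $$|e_n\rangle=\frac{(-N,N-2\alpha-\beta-2\zeta)_n}{(n-2\beta-2\zeta-1)_n}\sum_{\ell=0}^{N}(-1)^\ell\frac{(-n,n-2\beta-2\zeta-1)_\ell}{\ell!\,(-N,N-2\alpha-\beta-2\zeta)_\ell}|\ell\rangle,$$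 $$|e_n^*\rangle=\frac{(-N,n+N-2\alpha-\beta-2\zeta)_{N-n}}{(2\beta+2\zeta-N-n+1)_{N-n}}\sum_{\ell=0}^{N}\frac{(n-N,2\beta+2\zeta-N-n+1)_{N-\ell}}{(N-\ell)!\,(-N,2\alpha+\beta+2\zeta-2N+1)_{N-\ell}}|\ell\rangle,$$ $$|f_n\rangle=\frac{(\beta+\rho-N+1)_{N-n}}{(n-N,2\alpha+\rho-N-n)_{N-n}}\sum_{\ell=0}^{N}\frac{(n-N,2\alpha+\rho-N-n)_{N-\ell}}{(\beta+\rho-N+1)_{N-\ell}}|\ell\rangle,$$ $$|f_n^*\rangle=\frac{(-\beta-\rho)_n}{n!\,(n-2\alpha-\rho)_n}\sum_{\ell=0}^{N}(-1)^\ell\frac{(-n,n-2\alpha-\rho)_\ell}{(-\beta-\rho)_\ell}|\ell\rangle .$$ *)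

theory Defs
  imports Complex_Main "Jordan_Normal_Form.Matrix"
begin

definition poch :: "real list \<Rightarrow> nat \<Rightarrow> real" where
  "poch as n = (\<Prod>a\<leftarrow>as. pochhammer a n)"

text \<open>The terminating hypergeometric series is cut off at \<open>min i x\<close>. This matters because
  the lower parameter \<open>-N\<close> makes later terms of the form \<open>0 / 0\<close>.\<close>

definition racah :: "nat \<Rightarrow> nat \<Rightarrow> real \<Rightarrow> real \<Rightarrow> real \<Rightarrow> nat \<Rightarrow> real" where
  "racah i x \<alpha>' \<beta>' \<gamma>' N =
     (\<Sum>l = 0..min i x.
        poch [- real i, real i + \<alpha>' + \<beta>' + 1, - real x, real x + \<gamma>' - real N] l /
        (poch [\<alpha>' + 1, \<beta>' + \<gamma>' + 1, - real N] l * fact l))"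

text \<open>The coordinate of index \<open>l\<close>, for \<open>l = 0, \<dots>, N\<close>, belongs to the \<open>l\<close>-th standard basis
  vector of the \<open>(N + 1)\<close>-dimensional real space. The vectors \<open>e_vec\<close>, \<open>e_dual\<close>, \<open>f_vec\<close>,
  \<open>f_dual\<close> below are meaningful for \<open>n \<le> N\<close> only.

  With \<open>Z\<close>, \<open>X\<close>, \<open>V\<close> the operators acting on the standard basis \<open>b\<close> by

    \<open>Z b\<^sub>n = (n - \<alpha>) b\<^sub>n + b\<^sub>n\<^sub>+\<^sub>1\<close>,

    \<open>X b\<^sub>n = - (n - \<alpha>)\<^sup>2 b\<^sub>n - (n - \<beta>) b\<^sub>n\<^sub>+\<^sub>1\<close>,

    \<open>V b\<^sub>n = (n - \<beta> - \<zeta> - 1) (\<beta> + \<zeta> - n) b\<^sub>n + n (N + 1 - n) (n - 1 - 2 \<alpha> - \<beta> - 2 \<zeta> + N) b\<^sub>n\<^sub>-\<^sub>1\<close>,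

  they are eigenvectors of \<open>V\<close>, of its transpose, of \<open>X + \<rho> Z\<close> and of its transpose,
  in this order.\<close>

definition e_vec :: "nat \<Rightarrow> real \<Rightarrow> real \<Rightarrow> real \<Rightarrow> nat \<Rightarrow> real vec" where
  "e_vec N \<alpha> \<beta> \<zeta> n =
     (poch [- real N, real N - 2 * \<alpha> - \<beta> - 2 * \<zeta>] n / poch [real n - 2 * \<beta> - 2 * \<zeta> - 1] n) \<cdot>\<^sub>v
     vec (N + 1) (\<lambda>l. (-1) ^ l * (poch [- real n, real n - 2 * \<beta> - 2 * \<zeta> - 1] l /
        (fact l * poch [- real N, real N - 2 * \<alpha> - \<beta> - 2 * \<zeta>] l)))"

definition e_dual :: "nat \<Rightarrow> real \<Rightarrow> real \<Rightarrow> real \<Rightarrow> nat \<Rightarrow> real vec" where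
  "e_dual N \<alpha> \<beta> \<zeta> n =
     (poch [- real N, real n + real N - 2 * \<alpha> - \<beta> - 2 * \<zeta>] (N - n) /
      poch [2 * \<beta> + 2 * \<zeta> - real N - real n + 1] (N - n)) \<cdot>\<^sub>v
     vec (N + 1) (\<lambda>l. poch [real n - real N, 2 * \<beta> + 2 * \<zeta> - real N - real n + 1] (N - l) /
        (fact (N - l) * poch [- real N, 2 * \<alpha> + \<beta> + 2 * \<zeta> - 2 * real N + 1] (N - l)))"

definition f_vec :: "nat \<Rightarrow> real \<Rightarrow> real \<Rightarrow> real \<Rightarrow> nat \<Rightarrow> real vec" where
  "f_vec N \<alpha> \<beta> \<rho> n =
     (poch [\<beta> + \<rho> - real N + 1] (N - n) /
      poch [real n - real N, 2 * \<alpha> + \<rho> - real N - real n] (N - n)) \<cdot>\<^sub>v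
     vec (N + 1) (\<lambda>l. poch [real n - real N, 2 * \<alpha> + \<rho> - real N - real n] (N - l) /
        poch [\<beta> + \<rho> - real N + 1] (N - l))"

definition f_dual :: "nat \<Rightarrow> real \<Rightarrow> real \<Rightarrow> real \<Rightarrow> nat \<Rightarrow> real vec" where
  "f_dual N \<alpha> \<beta> \<rho> n =
     (poch [- \<beta> - \<rho>] n / (fact n * poch [real n - 2 * \<alpha> - \<rho>] n)) \<cdot>\<^sub>v
     vec (N + 1) (\<lambda>l. (-1) ^ l * (poch [- real n, real n - 2 * \<alpha> - \<rho>] l / poch [- \<beta> - \<rho>] l))"

definition S_fun :: "nat \<Rightarrow> real \<Rightarrow> real \<Rightarrow> real \<Rightarrow> real \<Rightarrow> nat \<Rightarrow> nat \<Rightarrow> real" where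
  "S_fun N \<alpha> \<beta> \<zeta> \<rho> m n = f_dual N \<alpha> \<beta> \<rho> n \<bullet> e_vec N \<alpha> \<beta> \<zeta> m"

definition S_tilde :: "nat \<Rightarrow> real \<Rightarrow> real \<Rightarrow> real \<Rightarrow> real \<Rightarrow> nat \<Rightarrow> nat \<Rightarrow> real" where
  "S_tilde N \<alpha> \<beta> \<zeta> \<rho> m n = f_vec N \<alpha> \<beta> \<rho> n \<bullet> e_dual N \<alpha> \<beta> \<zeta> m"

text \<open>Genericity: no denominator vanishes, listed in the order \<open>e_vec\<close>, \<open>e_dual\<close>, \<open>f_vec\<close>, \<open>f_dual\<close>,
  \<open>racah\<close>, and then the two closed formulas for \<open>S_fun\<close> and \<open>S_tilde\<close>. Factorials are left out, and
  \<open>k\<close> is any index in \<open>{0, \<dots>, N}\<close>, standing for \<open>n\<close>, \<open>m\<close>, \<open>l\<close> or \<open>N - l\<close>.\<close>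

definition generic_params ::
  "nat \<Rightarrow> real \<Rightarrow> real \<Rightarrow> real \<Rightarrow> real \<Rightarrow> real \<Rightarrow> real \<Rightarrow> real \<Rightarrow> bool" where
  "generic_params N \<alpha> \<beta> \<zeta> \<rho> \<alpha>' \<beta>' \<gamma>' \<longleftrightarrow> (\<forall>k\<le>N.
     poch [real k - 2 * \<beta> - 2 * \<zeta> - 1] k \<noteq> 0 \<and>
     poch [- real N, real N - 2 * \<alpha> - \<beta> - 2 * \<zeta>] k \<noteq> 0 \<and>
     poch [2 * \<beta> + 2 * \<zeta> - real N - real k + 1] (N - k) \<noteq> 0 \<and>
     poch [- real N, 2 * \<alpha> + \<beta> + 2 * \<zeta> - 2 * real N + 1] k \<noteq> 0 \<and>
     poch [real k - real N, 2 * \<alpha> + \<rho> - real N - real k] (N - k) \<noteq> 0 \<and>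
     poch [\<beta> + \<rho> - real N + 1] k \<noteq> 0 \<and>
     poch [real k - 2 * \<alpha> - \<rho>] k \<noteq> 0 \<and>
     poch [- \<beta> - \<rho>] k \<noteq> 0 \<and>
     poch [\<alpha>' + 1, \<beta>' + \<gamma>' + 1, - real N] k \<noteq> 0 \<and>
     poch [real k - real N + \<gamma>'] k \<noteq> 0 \<and>
     poch [real k + \<alpha>' + \<beta>' + 1] k \<noteq> 0 \<and>
     poch [- real N - real k - \<alpha>' - \<beta>' - 1] (N - k) \<noteq> 0 \<and>
     poch [real k - real N, - \<gamma>' - real k] (N - k) \<noteq> 0 \<and>
     poch [\<gamma>' - \<alpha>' - real N, - real N - \<beta>'] k \<noteq> 0)"

end

theory Submission
  imports Defs
begin

text \<open>
  The formula for \<^const>\<open>S_fun\<close> holds termwise: in the scalar product the signs \<open>(-1)\<^sup>l\<close> cancel,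
  the Pochhammer symbols of the two vectors are exactly the parameters of the Racah series, and
  everything that does not depend on \<open>l\<close> is the claimed prefactor.

  The same computation applied to \<^const>\<open>S_tilde\<close>, after the substitution \<open>l \<mapsto> N - l\<close>, yields a Racah
  polynomial of degree \<open>N - m\<close> at the point \<open>N - n\<close> with parameters
  \<open>(-\<alpha>' - N - 1, -\<beta>' - N - 1, -\<gamma>')\<close>. The substance of the theorem is therefore the reflection
  formula \<open>racah_poly_reflection\<close>, which turns this polynomial into the one of degree \<open>m\<close> at \<open>n\<close>, up to
  explicit factors.

  The reflection formula is a uniqueness statement for a second order recurrence in \<open>n\<close>. Racah
  polynomials satisfy a difference equation \<open>B(x) (f(x+1) - f(x)) - D(x) (f(x) - f(x-1)) = \<lambda>\<^sub>m f(x)\<close>. The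
  substitution \<open>x \<mapsto> N - x\<close> together with the change of parameters exchanges the roles of \<open>B\<close> and
  \<open>D\<close> up to linear factors, and these are absorbed by the gauge factor
  \<open>(\<gamma> - \<alpha> - N)\<^sub>n (-N - \<beta>)\<^sub>n / ((\<beta> + \<gamma> + 1)\<^sub>n (\<alpha> + 1)\<^sub>n)\<close>; the diagonal terms agree as well,
  since the eigenvalues of degree \<open>m\<close> and \<open>N - m\<close> differ by a quantity independent of \<open>m\<close>, which the
  change in \<open>B + D\<close> compensates. So both sides
  of the reflection formula obey one recurrence. For \<open>1 \<le> n < N\<close> it determines the value at \<open>n + 1\<close>
  from the two preceding ones, and the two sides agree at \<open>n = 0\<close> and \<open>n = 1\<close>.

  At \<open>n = 0\<close> the reflected series is evaluated at its right endpoint, where it is summed by the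
  Pfaff-Saalschuetz formula (\<open>racah_poly_endpoint\<close>). At \<open>n = 1\<close> the recurrence itself cannot be used:
  genericity permits \<open>\<gamma> = N\<close> and \<open>\<gamma> = N + 1\<close>, for which a denominator of \<open>B(0)\<close> or \<open>D(0)\<close> vanishes.
  The boundary form of the difference equation, with the offending factors cancelled, replaces it
  (\<open>racah_poly_difference_endpoint\<close>).

  All of this follows from two first order relations. The forward shift expresses the difference
  \<open>f(x+1) - f(x)\<close> by the Racah polynomial of degree \<open>m - 1\<close> with parameters
  \<open>(\<alpha> + 1, \<beta> + 1, \<gamma>, N - 1)\<close>, and the backward shift leads back. Their composition is the difference
  equation, and the backward shift at the endpoint gives the summation formula by induction on the
  degree.
\<close>

section \<open>Shift operators for Racah polynomials\<close>

text \<open>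
  The real variable \<open>x\<close> makes the relations below polynomial identities without boundary conditions,
  and the real \<open>\<nu>\<close> in place of \<open>N\<close> lets them pass from \<open>N\<close> to \<open>N - 1\<close>.
\<close>

definition racah_poly :: "nat \<Rightarrow> real \<Rightarrow> real \<Rightarrow> real \<Rightarrow> real \<Rightarrow> real \<Rightarrow> real" where
  "racah_poly m a b c \<nu> x = (\<Sum>l\<le>m.
     pochhammer (- real m) l * pochhammer (real m + a + b + 1) l *
       (pochhammer (- x) l * pochhammer (x + c - \<nu>) l) /
     (pochhammer (a + 1) l * pochhammer (b + c + 1) l * pochhammer (- \<nu>) l * fact l))"

text \<open>
  The products \<open>(-x)\<^sub>l (x + d)\<^sub>l\<close> are a Newton basis for polynomials in \<open>x (x + d)\<close>: a difference step
  lowers the index by one, raises \<open>d\<close> by one, and splits off the increment \<open>2 x + d + 1\<close> of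
  \<open>x (x + d)\<close>.
\<close>

lemma newton_basis_difference:
  fixes x d :: real
  shows "pochhammer (- (x + 1)) (Suc l) * pochhammer (x + 1 + d) (Suc l)
     - pochhammer (- x) (Suc l) * pochhammer (x + d) (Suc l)
     = - (real l + 1) * (2 * x + d + 1) * (pochhammer (- x) l * pochhammer (x + 1 + d) l)"
proof -
  have 1: "pochhammer (- (x + 1)) (Suc l) = - (x + 1) * pochhammer (- x) l"
    using pochhammer_rec[of "- (x + 1)" l] by simp
  have 2: "pochhammer (x + d) (Suc l) = (x + d) * pochhammer (x + 1 + d) l"
    using pochhammer_rec[of "x + d" l] by (simp add: add_ac)
  show ?thesis
    unfolding 1 2 unfolding pochhammer_Suc by Groebner_Basis.algebra
qed

text \<open>
  The difference is taken in the Newton basis; the coefficients of the series then move up by one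
  index, which amounts to raising every parameter of the series that is free of \<open>x\<close> by one.
\<close>

lemma racah_poly_forward_shift:
  "racah_poly (Suc m) a b c \<nu> (x + 1) - racah_poly (Suc m) a b c \<nu> x =
     (real m + 1) * (real m + a + b + 2) * (2 * x + c - \<nu> + 1) /
       ((a + 1) * (b + c + 1) * (- \<nu>)) * racah_poly m (a + 1) (b + 1) c (\<nu> - 1) x"
proof -
  define w where "w = (\<lambda>l. pochhammer (- real (Suc m)) l * pochhammer (real (Suc m) + a + b + 1) l /
     (pochhammer (a + 1) l * pochhammer (b + c + 1) l * pochhammer (- \<nu>) l * fact l))"
  define \<phi> where "\<phi> = (\<lambda>l x. pochhammer (- x) l * pochhammer (x + (c - \<nu>)) l)"
  have R: "racah_poly (Suc m) a b c \<nu> y = (\<Sum>l\<le>Suc m. w l * \<phi> l y)" for y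
    by (simp add: racah_poly_def w_def \<phi>_def add_diff_eq)
  have w: "w (Suc l) * (real l + 1) = - ((real m + 1) * (real m + a + b + 2) / ((a + 1) * (b + c + 1) * (- \<nu>))) *
      (pochhammer (- real m) l * pochhammer (real m + (a + 1) + (b + 1) + 1) l /
     (pochhammer (a + 1 + 1) l * pochhammer (b + 1 + c + 1) l * pochhammer (- (\<nu> - 1)) l * fact l))" for l
  proof -
    have "pochhammer (- real (Suc m)) (Suc l) = - (real m + 1) * pochhammer (- real m) l"
      using pochhammer_rec[of "- real (Suc m)" l] by simp
    moreover have "pochhammer (real (Suc m) + a + b + 1) (Suc l) =
        (real m + a + b + 2) * pochhammer (real m + (a + 1) + (b + 1) + 1) l"
      using pochhammer_rec[of "real (Suc m) + a + b + 1" l] by (simp add: add_ac)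
    moreover have "pochhammer (b + c + 1) (Suc l) = (b + c + 1) * pochhammer (b + 1 + c + 1) l"
      using pochhammer_rec[of "b + c + 1" l] by (simp add: add_ac)
    moreover have "pochhammer (- \<nu>) (Suc l) = - \<nu> * pochhammer (- (\<nu> - 1)) l"
      using pochhammer_rec[of "- \<nu>" l] by simp
    moreover have "fact (Suc l) = (real l + 1) * fact l"
      by simp
    ultimately show ?thesis
      unfolding w_def pochhammer_rec[of "a + 1"]
      by (simp only:) (simp add: divide_simps del: fact_Suc, simp add: algebra_simps)
  qed
  have "racah_poly (Suc m) a b c \<nu> (x + 1) - racah_poly (Suc m) a b c \<nu> x =
      (\<Sum>l\<le>Suc m. w l * (\<phi> l (x + 1) - \<phi> l x))"
    by (simp only: R sum_subtractf right_diff_distrib)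
  also have "\<dots> = (\<Sum>l\<le>m. w (Suc l) * (\<phi> (Suc l) (x + 1) - \<phi> (Suc l) x))"
    by (subst sum.atMost_Suc_shift) (simp add: \<phi>_def)
  also have "\<dots> = (\<Sum>l\<le>m. w (Suc l) * (real l + 1) * (- (2 * x + c - \<nu> + 1)) *
      (pochhammer (- x) l * pochhammer (x + c - (\<nu> - 1)) l))"
    unfolding \<phi>_def newton_basis_difference
    by (intro sum.cong refl) (simp add: algebra_simps)
  also have "\<dots> = (real m + 1) * (real m + a + b + 2) * (2 * x + c - \<nu> + 1) /
       ((a + 1) * (b + c + 1) * (- \<nu>)) * racah_poly m (a + 1) (b + 1) c (\<nu> - 1) x"
    unfolding racah_poly_def sum_distrib_left w divide_inverse
    by (intro sum.cong refl) Groebner_Basis.algebra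
  finally show ?thesis .
qed

text \<open>
  This sum is what both versions of the backward shift reduce to. Its left side carries the
  coefficients of the polynomial of degree \<open>m\<close> with parameters \<open>(a + 1, b + 1, c, \<nu> - 1)\<close>. The first
  part of the bracket raises the index of the basis function \<open>(-x)\<^sub>k (x + c - \<nu>)\<^sub>k\<close>, the second part
  keeps it and turns the shifted denominators back into the unshifted ones. Collecting the two
  contributions to each basis function produces the coefficients of degree \<open>m + 1\<close>, by
  \<open>(k - m) (m + k + s + 2) - (k + 1) (k + 1 + s) = - (m + 1) (m + 1 + s)\<close> with \<open>s = a + b + 1\<close>.
\<close>

lemma racah_poly_lowering_sum:
  assumes A: "pochhammer (a + 1) (Suc m) \<noteq> 0" and B: "pochhammer (b + c + 1) (Suc m) \<noteq> 0"
    and V: "pochhammer (- \<nu>) (Suc m) \<noteq> 0"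
  shows "(\<Sum>k\<le>m. pochhammer (- real m) k * pochhammer (real m + (a + 1) + (b + 1) + 1) k /
        (pochhammer (a + 1 + 1) k * pochhammer (b + 1 + c + 1) k * pochhammer (- (\<nu> - 1)) k * fact k) *
        ((real k + a + b + 2) * (real k - x) * (x + c - \<nu> + real k)
          - (a + 1 + real k) * (b + c + 1 + real k) * (real k - \<nu>)) *
        (pochhammer (- x) k * pochhammer (x + c - \<nu>) k))
    = (a + 1) * (b + c + 1) * \<nu> * racah_poly (Suc m) a b c \<nu> x"
proof -
  define K where "K = (a + 1) * (b + c + 1) * \<nu>"
  define D where "D = (\<lambda>l. pochhammer (a + 1) l * pochhammer (b + c + 1) l * pochhammer (- \<nu>) l)"
  define p where "p = (\<lambda>l. pochhammer (- real m) l * pochhammer (real m + a + b + 3) l)"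
  define w where "w = (\<lambda>l. pochhammer (- real (Suc m)) l * pochhammer (real (Suc m) + a + b + 1) l / (D l * fact l))"
  define u where "u = (\<lambda>l. p l / (D l * fact l))"
  define t where "t = (\<lambda>l. p l * (real l + a + b + 2) / (D (Suc l) * fact l))"
  define \<phi> where "\<phi> = (\<lambda>l. pochhammer (- x) l * pochhammer (x + c - \<nu>) l)"
  have D0: "D l \<noteq> 0" if "l \<le> Suc m" for l
    using that A B V by (auto simp: D_def pochhammer_eq_0_iff)
  have DS: "D (Suc l) = (a + 1 + real l) * (b + c + 1 + real l) * (real l - \<nu>) * D l" for l
    by (simp add: D_def pochhammer_Suc algebra_simps)
  have DS': "D (Suc l) = - K * (pochhammer (a + 1 + 1) l * pochhammer (b + 1 + c + 1) l * pochhammer (- (\<nu> - 1)) l)" for l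
    by (simp add: D_def K_def pochhammer_rec add_ac)
  have K0: "K \<noteq> 0" using A B V by (auto simp: K_def pochhammer_rec)
  have \<phi>S: "(real k - x) * (x + c - \<nu> + real k) * \<phi> k = \<phi> (Suc k)" for k
    by (simp add: \<phi>_def pochhammer_Suc algebra_simps)
  have summand: "pochhammer (- real m) k * pochhammer (real m + (a + 1) + (b + 1) + 1) k /
        (pochhammer (a + 1 + 1) k * pochhammer (b + 1 + c + 1) k * pochhammer (- (\<nu> - 1)) k * fact k) *
        ((real k + a + b + 2) * (real k - x) * (x + c - \<nu> + real k)
          - (a + 1 + real k) * (b + c + 1 + real k) * (real k - \<nu>)) * \<phi> k
      = K * (u k * \<phi> k - t k * \<phi> (Suc k))" if "k \<le> m" for k
  proof -
    have k: "D (Suc k) \<noteq> 0" using D0 that by simp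
    define C where "C = pochhammer (a + 1 + 1) k * pochhammer (b + 1 + c + 1) k * pochhammer (- (\<nu> - 1)) k"
    define h where "h = (a + 1 + real k) * (b + c + 1 + real k) * (real k - \<nu>)"
    have C: "D (Suc k) = - K * C" using DS' C_def by simp
    have h: "h * D k = - K * C" using C DS h_def by simp
    have nz: "C \<noteq> 0" "h \<noteq> 0" "D k \<noteq> 0" using k C h K0 by auto
    have "p k / (C * fact k) * (((real k + a + b + 2) * (real k - x) * (x + c - \<nu> + real k) - h) * \<phi> k)
      = K * (u k * \<phi> k - t k * ((real k - x) * (x + c - \<nu> + real k) * \<phi> k))"
    proof -
      have "D k = - K * C / h" using nz h by (simp add: field_simps)
      then have "K * u k = - (p k * h) * inverse (C * fact k)"
        unfolding u_def \<open>D k = - K * C / h\<close> using nz K0 by (simp add: field_simps)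
      moreover have "K * t k = - (p k * (real k + a + b + 2)) * inverse (C * fact k)"
        unfolding t_def C using nz K0 by (simp add: field_simps)
      ultimately show ?thesis unfolding divide_inverse by Groebner_Basis.algebra
    qed
    moreover have "p k = pochhammer (- real m) k * pochhammer (real m + (a + 1) + (b + 1) + 1) k"
      by (simp add: p_def add_ac)
    ultimately show ?thesis unfolding \<phi>S C_def h_def by (simp add: mult.assoc)
  qed
  \<comment> \<open>\<open>w\<close> are the coefficients of degree \<open>m + 1\<close>; index \<open>l + 1\<close> receives \<open>u\<close> from its own term and
      \<open>- t\<close> from the preceding one.\<close>
  have wS: "w (Suc l) = u (Suc l) - t l" if "l \<le> m" for l
  proof -
    have nz: "D (Suc l) \<noteq> 0" using D0 that by simp
    have pS: "p (Suc l) = p l * ((real l - real m) * (real m + a + b + 3 + real l))"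
      by (simp add: p_def pochhammer_Suc algebra_simps)
    have w: "pochhammer (- real (Suc m)) (Suc l) * pochhammer (real (Suc m) + a + b + 1) (Suc l)
       = p l * (- (real m + 1) * (real m + a + b + 2))"
      by (simp add: p_def pochhammer_rec add_ac)
    show ?thesis unfolding w_def u_def t_def w pS using nz
      by (simp add: divide_simps) (simp add: algebra_simps)
  qed
  have "(\<Sum>k\<le>m. K * (u k * \<phi> k - t k * \<phi> (Suc k)))
      = K * ((\<Sum>k\<le>m. u k * \<phi> k) - (\<Sum>k\<le>m. t k * \<phi> (Suc k)))"
    by (simp only: sum_distrib_left[symmetric] sum_subtractf)
  \<comment> \<open>The extra term vanishes since \<open>(-m)\<^sub>m\<^sub>+\<^sub>1 = 0\<close>.\<close>
  also have "(\<Sum>k\<le>m. u k * \<phi> k) = (\<Sum>k\<le>Suc m. u k * \<phi> k)"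
    by (simp add: u_def p_def pochhammer_of_nat_eq_0_iff)
  also have "\<dots> = u 0 * \<phi> 0 + (\<Sum>k\<le>m. u (Suc k) * \<phi> (Suc k))"
    by (rule sum.atMost_Suc_shift)
  also have "u 0 * \<phi> 0 + (\<Sum>k\<le>m. u (Suc k) * \<phi> (Suc k)) - (\<Sum>k\<le>m. t k * \<phi> (Suc k))
      = w 0 * \<phi> 0 + (\<Sum>k\<le>m. w (Suc k) * \<phi> (Suc k))"
    by (simp add: wS left_diff_distrib sum_subtractf) (simp add: u_def w_def p_def)
  also have "\<dots> = (\<Sum>k\<le>Suc m. w k * \<phi> k)"
    by (rule sum.atMost_Suc_shift[symmetric])
  also have "\<dots> = racah_poly (Suc m) a b c \<nu> x"
    by (simp only: racah_poly_def w_def \<phi>_def D_def times_divide_eq_left mult.assoc)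
  finally have total: "(\<Sum>k\<le>m. K * (u k * \<phi> k - t k * \<phi> (Suc k))) = K * racah_poly (Suc m) a b c \<nu> x" .
  show ?thesis
    unfolding K_def[symmetric] total[symmetric]
    using summand by (intro sum.cong refl) (simp only: \<phi>_def atMost_iff)
qed

text \<open>
  Since \<open>(x + c - \<nu>) (x + c - \<nu> + 1)\<^sub>k\<close> is a multiple of \<open>(x + c - \<nu>)\<^sub>k\<close> and \<open>x (1 - x)\<^sub>k\<close> one of
  \<open>(-x)\<^sub>k\<close>, each summand on the left is a polynomial in \<open>x\<close> and \<open>k\<close> times
  \<open>(-x)\<^sub>k (x + c - \<nu>)\<^sub>k\<close>. This polynomial is divisible by \<open>2 x + c - \<nu>\<close>, and up to sign the quotient
  is the bracket of \<open>racah_poly_lowering_sum\<close>.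
\<close>

lemma racah_poly_backward_shift:
  assumes "pochhammer (a + 1) (Suc m) \<noteq> 0" "pochhammer (b + c + 1) (Suc m) \<noteq> 0"
    "pochhammer (- \<nu>) (Suc m) \<noteq> 0"
  shows "(x + a + 1) * (x + b + c + 1) * (x - \<nu>) * (x + c - \<nu>) * racah_poly m (a + 1) (b + 1) c (\<nu> - 1) x
     - x * (x + c) * (x + c - \<nu> - a - 1) * (x - \<nu> - b - 1) * racah_poly m (a + 1) (b + 1) c (\<nu> - 1) (x - 1)
     = - (2 * x + c - \<nu>) * ((a + 1) * (b + c + 1) * \<nu>) * racah_poly (Suc m) a b c \<nu> x"
proof -
  have eq: "(x + a + 1) * (x + b + c + 1) * (x - \<nu>) * (x + c - \<nu>) *
       (q * (pochhammer (- x) k * pochhammer (x + c - (\<nu> - 1)) k) / r)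
     - x * (x + c) * (x + c - \<nu> - a - 1) * (x - \<nu> - b - 1) *
       (q * (pochhammer (- (x - 1)) k * pochhammer (x - 1 + c - (\<nu> - 1)) k) / r)
     = - (2 * x + c - \<nu>) * (q / r *
        ((real k + a + b + 2) * (real k - x) * (x + c - \<nu> + real k)
          - (a + 1 + real k) * (b + c + 1 + real k) * (real k - \<nu>)) *
        (pochhammer (- x) k * pochhammer (x + c - \<nu>) k))" for k q r
  proof -
    define P Q where "P = pochhammer (- x) k" and "Q = pochhammer (x + c - \<nu>) k"
    have 1: "(x + c - \<nu>) * pochhammer (x + c - (\<nu> - 1)) k = Q * (x + c - \<nu> + real k)"
      using pochhammer_rec[of "x + c - \<nu>" k] pochhammer_Suc[of "x + c - \<nu>" k]
      by (simp add: Q_def algebra_simps)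
    have 2: "x * pochhammer (- (x - 1)) k = P * (x - real k)"
      using pochhammer_rec[of "- x" k] pochhammer_Suc[of "- x" k]
      by (simp add: P_def algebra_simps)
    have 3: "pochhammer (x - 1 + c - (\<nu> - 1)) k = Q"
      unfolding Q_def by (rule arg_cong[where f = "\<lambda>y. pochhammer y k"]) simp
    have e1: "(x + a + 1) * (x + b + c + 1) * (x - \<nu>) * (x + c - \<nu>) *
       (q * (pochhammer (- x) k * pochhammer (x + c - (\<nu> - 1)) k) / r)
      = (x + a + 1) * (x + b + c + 1) * (x - \<nu>) * q * P / r * ((x + c - \<nu>) * pochhammer (x + c - (\<nu> - 1)) k)"
      by (simp add: P_def)
    have e2: "x * (x + c) * (x + c - \<nu> - a - 1) * (x - \<nu> - b - 1) *
       (q * (pochhammer (- (x - 1)) k * pochhammer (x - 1 + c - (\<nu> - 1)) k) / r)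
      = (x + c) * (x + c - \<nu> - a - 1) * (x - \<nu> - b - 1) * q * Q / r * (x * pochhammer (- (x - 1)) k)"
      unfolding 3 by simp
    have scale: "X * q * P / r * (Q * y) - X' * q * Q / r * (P * y') = z * (q / r * w * (P * Q))"
      if "X * y - X' * y' = z * w" for X X' y y' z w :: real
      unfolding divide_inverse using that by Groebner_Basis.algebra
    have e3: "(x + a + 1) * (x + b + c + 1) * (x - \<nu>) * (x + c - \<nu> + real k)
        - (x + c) * (x + c - \<nu> - a - 1) * (x - \<nu> - b - 1) * (x - real k)
      = - (2 * x + c - \<nu>) *
        ((real k + a + b + 2) * (real k - x) * (x + c - \<nu> + real k)
          - (a + 1 + real k) * (b + c + 1 + real k) * (real k - \<nu>))"
      by Groebner_Basis.algebra
    show ?thesis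
      unfolding e1 e2 unfolding 1 2 unfolding P_def[symmetric] Q_def[symmetric]
      by (rule scale[OF e3])
  qed
  show ?thesis
    unfolding mult.assoc[of "- (2 * x + c - \<nu>)"] racah_poly_lowering_sum[OF assms, of x, symmetric]
    unfolding racah_poly_def sum_distrib_left sum_subtractf[symmetric]
    by (intro sum.cong refl) (rule eq)
qed

text \<open>
  At \<open>x = \<nu>\<close> the first term of the backward shift vanishes, and the factor \<open>x + c\<close> of the second
  equals \<open>2 x + c - \<nu>\<close>. The version with this common factor cancelled also covers
  \<open>c = - \<nu>\<close>, where the general relation reads \<open>0 = 0\<close>.
\<close>

lemma racah_poly_backward_shift_endpoint:
  assumes "pochhammer (a + 1) (Suc m) \<noteq> 0" "pochhammer (b + c + 1) (Suc m) \<noteq> 0"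
    "pochhammer (- \<nu>) (Suc m) \<noteq> 0"
  shows "(a + 1 - c) * (b + 1) * racah_poly m (a + 1) (b + 1) c (\<nu> - 1) (\<nu> - 1)
     = (a + 1) * (b + c + 1) * racah_poly (Suc m) a b c \<nu> \<nu>"
proof -
  have nz: "\<nu> \<noteq> 0" using assms(3) by (auto simp: pochhammer_rec)
  have eq: "\<nu> * ((a + 1 - c) * (b + 1)) * (q * (pochhammer (- (\<nu> - 1)) k * pochhammer (\<nu> - 1 + c - (\<nu> - 1)) k) / r)
     = q / r *
        ((real k + a + b + 2) * (real k - \<nu>) * (\<nu> + c - \<nu> + real k)
          - (a + 1 + real k) * (b + c + 1 + real k) * (real k - \<nu>)) *
        (pochhammer (- \<nu>) k * pochhammer (\<nu> + c - \<nu>) k)" for k q r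
  proof -
    define P Q where "P = pochhammer (- \<nu>) k" and "Q = pochhammer c k"
    have 2: "\<nu> * pochhammer (- (\<nu> - 1)) k = P * (\<nu> - real k)"
      using pochhammer_rec[of "- \<nu>" k] pochhammer_Suc[of "- \<nu>" k]
      by (simp add: P_def algebra_simps)
    have "\<nu> * ((a + 1 - c) * (b + 1)) * (q * (pochhammer (- (\<nu> - 1)) k * pochhammer (\<nu> - 1 + c - (\<nu> - 1)) k) / r)
      = (a + 1 - c) * (b + 1) * q * Q / r * (\<nu> * pochhammer (- (\<nu> - 1)) k)"
      by (simp add: Q_def)
    also have "\<dots> = q / r *
        ((real k + a + b + 2) * (real k - \<nu>) * (c + real k)
          - (a + 1 + real k) * (b + c + 1 + real k) * (real k - \<nu>)) * (P * Q)"
      unfolding 2 divide_inverse by Groebner_Basis.algebra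
    finally show ?thesis by (simp add: P_def Q_def)
  qed
  have "\<nu> * ((a + 1 - c) * (b + 1)) * racah_poly m (a + 1) (b + 1) c (\<nu> - 1) (\<nu> - 1)
     = (a + 1) * (b + c + 1) * \<nu> * racah_poly (Suc m) a b c \<nu> \<nu>"
    unfolding racah_poly_lowering_sum[OF assms, of \<nu>, symmetric]
    unfolding racah_poly_def sum_distrib_left
    by (intro sum.cong refl) (rule eq)
  then show ?thesis using nz by simp
qed

lemma racah_poly_0 [simp]: "racah_poly 0 a b c \<nu> x = 1"
  by (simp add: racah_poly_def)

lemma racah_poly_at_0 [simp]: "racah_poly m a b c \<nu> 0 = 1"
  unfolding racah_poly_def by (subst sum.remove[of _ 0]) (auto intro!: sum.neutral simp: pochhammer_0_left)

section \<open>Summation formula and difference equation\<close>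

text \<open>
  At \<open>x = \<nu>\<close> the factor \<open>(-x)\<^sub>l\<close> cancels \<open>(-\<nu>)\<^sub>l\<close>, so this is the Pfaff-Saalschuetz sum of a terminating
  balanced \<open>\<^sub>3F\<^sub>2\<close>. One use of the backward shift peels off one factor of each Pochhammer symbol.
\<close>

lemma racah_poly_endpoint:
  assumes "pochhammer (a + 1) m \<noteq> 0" "pochhammer (b + c + 1) m \<noteq> 0" "pochhammer (- \<nu>) m \<noteq> 0"
  shows "pochhammer (a + 1) m * pochhammer (b + c + 1) m * racah_poly m a b c \<nu> \<nu>
     = pochhammer (a + 1 - c) m * pochhammer (b + 1) m"
  using assms
proof (induction m arbitrary: a b \<nu>)
  case (Suc m)
  have "pochhammer (a + 1 + 1) m * pochhammer (b + 1 + c + 1) m * racah_poly m (a + 1) (b + 1) c (\<nu> - 1) (\<nu> - 1)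
     = pochhammer (a + 1 + 1 - c) m * pochhammer (b + 1 + 1) m"
    using Suc.prems by (intro Suc.IH) (auto simp: pochhammer_rec add_ac)
  moreover have "pochhammer (b + c + 1) (Suc m) = (b + c + 1) * pochhammer (b + 1 + c + 1) m"
    using pochhammer_rec[of "b + c + 1" m] by (simp add: add_ac)
  moreover have "pochhammer (a + 1 - c) (Suc m) = (a + 1 - c) * pochhammer (a + 1 + 1 - c) m"
    using pochhammer_rec[of "a + 1 - c" m] by (simp add: algebra_simps)
  moreover note racah_poly_backward_shift_endpoint[OF Suc.prems]
    pochhammer_rec[of "a + 1" m] pochhammer_rec[of "b + 1" m]
  ultimately show ?case by Groebner_Basis.algebra
qed simp

text \<open>
  Forward shifts at \<open>x\<close> and \<open>x - 1\<close> followed by a backward shift. The denominators of the usual form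
  are cleared.
\<close>

lemma racah_poly_difference_equation:
  assumes "pochhammer (a + 1) m \<noteq> 0" "pochhammer (b + c + 1) m \<noteq> 0" "pochhammer (- \<nu>) m \<noteq> 0"
  shows "(2 * x + c - \<nu> - 1) * ((x + a + 1) * (x + b + c + 1) * (x - \<nu>) * (x + c - \<nu>)) *
       (racah_poly m a b c \<nu> (x + 1) - racah_poly m a b c \<nu> x)
     - (2 * x + c - \<nu> + 1) * (x * (x + c) * (x + c - \<nu> - a - 1) * (x - \<nu> - b - 1)) *
       (racah_poly m a b c \<nu> x - racah_poly m a b c \<nu> (x - 1))
     = real m * (real m + a + b + 1) *
       ((2 * x + c - \<nu> - 1) * (2 * x + c - \<nu>) * (2 * x + c - \<nu> + 1)) * racah_poly m a b c \<nu> x"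
proof (cases m)
  case (Suc k)
  define K where "K = (a + 1) * (b + c + 1) * (- \<nu>)"
  have K: "K \<noteq> 0" using assms Suc by (auto simp: K_def pochhammer_rec)
  define L where "L = (real k + 1) * (real k + a + b + 2)"
  define V where "V = racah_poly k (a + 1) (b + 1) c (\<nu> - 1)"
  define g where "g = 2 * x + c - \<nu>"
  define A D where "A = (x + a + 1) * (x + b + c + 1) * (x - \<nu>) * (x + c - \<nu>)"
    and "D = x * (x + c) * (x + c - \<nu> - a - 1) * (x - \<nu> - b - 1)"
  have "racah_poly m a b c \<nu> (x + 1) - racah_poly m a b c \<nu> x = L * (g + 1) / K * V x"
    using racah_poly_forward_shift[of k a b c \<nu> x] by (simp add: Suc K_def L_def V_def g_def)
  moreover have "racah_poly m a b c \<nu> x - racah_poly m a b c \<nu> (x - 1) = L * (g - 1) / K * V (x - 1)"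
    using racah_poly_forward_shift[of k a b c \<nu> "x - 1"]
    by (simp add: Suc K_def L_def V_def g_def right_diff_distrib add_diff_eq diff_add_eq)
  moreover have "A * V x - D * V (x - 1) = g * K * racah_poly m a b c \<nu> x"
    using racah_poly_backward_shift[of a k b c \<nu> x] assms
    unfolding Suc A_def D_def V_def g_def K_def by (simp add: algebra_simps)
  moreover have "real m * (real m + a + b + 1) = L" by (simp add: Suc L_def add_ac)
  ultimately show ?thesis
    using K unfolding A_def[symmetric] D_def[symmetric] g_def[symmetric]
    by (simp add: divide_simps) Groebner_Basis.algebra
qed simp

text \<open>
  The difference equation at \<open>x = \<nu>\<close> has the common factor \<open>(\<nu> + c) (\<nu> + c + 1)\<close>, which may be zero.
  Working from the endpoint form of the backward shift gives the equation with this factor cancelled.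
\<close>

lemma racah_poly_difference_endpoint:
  assumes "pochhammer (a + 1) m \<noteq> 0" "pochhammer (b + c + 1) m \<noteq> 0" "pochhammer (- \<nu>) m \<noteq> 0"
  shows "\<nu> * (a + 1 - c) * (b + 1) * (racah_poly m a b c \<nu> \<nu> - racah_poly m a b c \<nu> (\<nu> - 1))
     = - (real m * (real m + a + b + 1) * (\<nu> + c - 1)) * racah_poly m a b c \<nu> \<nu>"
proof (cases m)
  case (Suc k)
  define K where "K = (a + 1) * (b + c + 1) * (- \<nu>)"
  have K: "K \<noteq> 0" using assms Suc by (auto simp: K_def pochhammer_rec)
  define L where "L = (real k + 1) * (real k + a + b + 2)"
  define V where "V = racah_poly k (a + 1) (b + 1) c (\<nu> - 1) (\<nu> - 1)"
  have "racah_poly m a b c \<nu> \<nu> - racah_poly m a b c \<nu> (\<nu> - 1) = L * (\<nu> + c - 1) / K * V"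
    using racah_poly_forward_shift[of k a b c \<nu> "\<nu> - 1"]
    by (simp add: Suc K_def L_def V_def right_diff_distrib add_diff_eq diff_add_eq)
  moreover have "\<nu> * (a + 1 - c) * (b + 1) * V = - K * racah_poly m a b c \<nu> \<nu>"
    using racah_poly_backward_shift_endpoint[of a k b c \<nu>] assms
    unfolding Suc V_def K_def by simp
  moreover have "real m * (real m + a + b + 1) = L" by (simp add: Suc L_def add_ac)
  ultimately show ?thesis
    using K by (simp add: divide_simps) Groebner_Basis.algebra
qed simp

section \<open>The reflection formula\<close>

lemma pochhammer_reflect:
  fixes y :: real
  shows "pochhammer (- y - real k) k = (-1) ^ k * pochhammer (y + 1) k"
  using pochhammer_minus[of "y + real k" k] by simp

text \<open>
  Both sides, as functions of \<open>n\<close>, solve the same three-term recurrence and have the same initial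
  values at \<open>0\<close> and \<open>1\<close>. The last assumption keeps the leading coefficient of the recurrence away
  from zero; it involves \<open>j = n\<close> and \<open>j = 2 n - 1\<close> for \<open>1 \<le> n < N\<close>.
\<close>

lemma racah_poly_reflection:
  fixes N m n :: nat and a b c :: real
  assumes mN: "m \<le> N" and nN: "n \<le> N"
    and A: "pochhammer (a + 1) N \<noteq> 0" and B: "pochhammer (b + c + 1) N \<noteq> 0"
    and G: "\<And>j. \<lbrakk>1 \<le> j; j < 2 * N\<rbrakk> \<Longrightarrow> real j - real N + c \<noteq> 0"
  shows "pochhammer (c - a - real N) n * pochhammer (- real N - b) n *
      (pochhammer (b + c + 1 + real m) (N - m) * pochhammer (a + 1 + real m) (N - m)) *
      racah_poly (N - m) (- a - real N - 1) (- b - real N - 1) (- c) (real N) (real N - real n)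
    = pochhammer (b + c + 1) n * pochhammer (a + 1) n *
      (pochhammer (c - a - real N) (N - m) * pochhammer (- real N - b) (N - m)) *
      racah_poly m a b c (real N) (real n)"
proof -
  define M where "M = N - m"
  have M: "real M = real N - real m" "M \<le> N" using mN by (auto simp: M_def)
  define p where "p = racah_poly m a b c (real N)"
  define q where "q = racah_poly M (- a - real N - 1) (- b - real N - 1) (- c) (real N)"
  define K1 where "K1 = pochhammer (b + c + 1 + real m) M * pochhammer (a + 1 + real m) M"
  define K2 where "K2 = pochhammer (c - a - real N) M * pochhammer (- real N - b) M"
  define F where "F = (\<lambda>n. pochhammer (c - a - real N) n * pochhammer (- real N - b) n * K1 * q (real N - real n))"
  define H where "H = (\<lambda>n. pochhammer (b + c + 1) n * pochhammer (a + 1) n * K2 * p (real n))"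
  have p_nz: "pochhammer (a + 1) m \<noteq> 0" "pochhammer (b + c + 1) m \<noteq> 0" "pochhammer (- real N) m \<noteq> 0"
    using A B mN by (auto simp: pochhammer_eq_0_iff)
  have flip: "pochhammer (- y - real N + 1) M = (-1) ^ M * pochhammer (y + real m) M" for y
    using pochhammer_reflect[of "y + real m - 1" M] M by (simp add: algebra_simps)
  have flip_nz: "pochhammer (y + real m) M \<noteq> 0" if "pochhammer y N \<noteq> 0" for y :: real
    using that mN pochhammer_product'[of y m M] by (simp add: M_def)
  have qa: "pochhammer (- a - real N - 1 + 1) M = (-1) ^ M * pochhammer (a + 1 + real m) M"
    using flip[of "a + 1"] by (simp add: algebra_simps)
  have qb: "pochhammer (- b - real N - 1 + - c + 1) M = (-1) ^ M * pochhammer (b + c + 1 + real m) M"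
    using flip[of "b + c + 1"] by (simp add: algebra_simps)
  have q_nz: "pochhammer (- a - real N - 1 + 1) M \<noteq> 0" "pochhammer (- b - real N - 1 + - c + 1) M \<noteq> 0"
      "pochhammer (- real N) M \<noteq> 0"
    unfolding qa qb using flip_nz[OF A] flip_nz[OF B] M by (auto simp: pochhammer_of_nat_eq_0_iff)
  have F0: "F 0 = H 0"
  proof -
    have "K1 * q (real N) = pochhammer (- a - real N - 1 + 1) M * pochhammer (- b - real N - 1 + - c + 1) M * q (real N)"
      unfolding qa qb K1_def by (simp add: mult_ac flip: power_add mult_2)
    also have "\<dots> = K2"
    proof -
      have "- a - real N - 1 + 1 - - c = c - a - real N" "- b - real N - 1 + 1 = - real N - b"
        by simp_all
      then show ?thesis unfolding q_def racah_poly_endpoint[OF q_nz] K2_def by (simp only:)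
    qed
    finally show ?thesis by (simp add: F_def H_def p_def)
  qed
  \<comment> \<open>Both values at \<open>1\<close> are multiples of the common value at \<open>0\<close>: on the right by one forward shift
    from \<open>x = 0\<close>, on the left by the difference equation at the endpoint \<open>x = N\<close>.\<close>
  have F1: "F 1 = H 1" if "N \<ge> 1"
  proof -
    define g where "g = c - real N"
    have nz: "(a + 1) * (b + c + 1) \<noteq> 0" using A B that by (cases N) (auto simp: pochhammer_rec)
    have "p 1 - 1 = real m * (real m + a + b + 1) * (g + 1) / ((a + 1) * (b + c + 1) * (- real N))"
    proof (cases m)
      case (Suc k)
      have "racah_poly k (a + 1) (b + 1) c (real N - 1) 0 = 1" by simp
      with racah_poly_forward_shift[of k a b c "real N" 0] show ?thesis
        by (simp add: p_def g_def Suc add_ac diff_add_eq)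
    qed (simp add: p_def)
    then have p1: "(a + 1) * (b + c + 1) * real N * (p 1 - 1) = - (real m * (real m + a + b + 1) * (g + 1))"
      using nz that by (simp add: divide_simps mult_ac)
    have q1: "real N * (c - a - real N) * (- real N - b) * (q (real N) - q (real N - 1))
        = - ((real N - real m) * (real N + real m + a + b + 1) * (g + 1)) * q (real N)"
    proof -
      have *: "- a - real N - 1 + 1 - - c = c - a - real N" "- b - real N - 1 + 1 = - real N - b"
        "real M + (- a - real N - 1) + (- b - real N - 1) + 1 = - (real N + real m + a + b + 1)"
        "real N + - c - 1 = - (g + 1)"
        using M(1) by (simp_all add: g_def)
      show ?thesis
        using racah_poly_difference_endpoint[OF q_nz] unfolding * q_def[symmetric] M(1)[symmetric]
        by (simp only: mult_minus_left mult_minus_right minus_minus)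
    qed
    define T W where "T = real N * (c - a - real N) * (- real N - b)"
      and "W = (real N - real m) * (real N + real m + a + b + 1) * (g + 1)"
    have "T * q (real N - 1) = (T + W) * q (real N)"
      using q1 unfolding T_def[symmetric] W_def[symmetric] by (simp add: algebra_simps)
    then have "real N * F 1 = (T + W) * (K1 * q (real N))"
      by (simp add: F_def T_def mult_ac)
    also have "K1 * q (real N) = K2"
      using F0 by (simp add: F_def H_def p_def)
    also have "T + W = (a + 1) * (b + c + 1) * real N - real m * (real m + a + b + 1) * (g + 1)"
      unfolding T_def W_def g_def by (simp add: algebra_simps)
    also have "\<dots> = (a + 1) * (b + c + 1) * real N * p 1"
      using p1 unfolding right_diff_distrib by simp
    also have "\<dots> * K2 = real N * H 1"
      by (simp add: H_def)
    finally have "real N * F 1 = real N * H 1" .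
    then show ?thesis using that by simp
  qed
  have step: "F (Suc (Suc n)) = H (Suc (Suc n))"
    if "F n = H n" "F (Suc n) = H (Suc n)" "Suc (Suc n) \<le> N" for n
  proof -
    \<comment> \<open>\<open>X A1\<close> and \<open>Y B1\<close> are the coefficients of the difference equation of \<open>p\<close> at \<open>x\<close>, and \<open>X A2\<close>,
      \<open>Y B2\<close> those of \<open>q\<close> at \<open>N - x\<close>, where the reflection has exchanged the two neighbours.\<close>
    define x where "x = real (Suc n)"
    define g where "g = c - real N"
    define X where "X = (2 * x + g - 1) * (x - real N) * (x + g)"
    define Y where "Y = (2 * x + g + 1) * x * (x + c)"
    define J where "J = (2 * x + g - 1) * (2 * x + g) * (2 * x + g + 1)"
    define L L' where "L = real m * (real m + a + b + 1) * J"
      and "L' = - ((real N - real m) * (real N + real m + a + b + 1)) * J"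
    define A1 A2 B1 B2 where "A1 = (x + a + 1) * (x + b + c + 1)" and "A2 = (x + g - a) * (x - real N - b)"
      and "B1 = (x + g - a - 1) * (x - real N - b - 1)" and "B2 = (x + a) * (x + b + c)"
    define E where "E = X * A1 + Y * B1 + L"
    \<comment> \<open>The diagonal coefficients agree: the changes in \<open>X A\<close>, in \<open>Y B\<close> and in the eigenvalue term are
      all multiples of \<open>s\<close>, and they cancel.\<close>
    have E': "E = X * A2 + Y * B2 + L'"
    proof -
      define s where "s = real N + a + b + 1"
      have "A1 = A2 + (2 * x + g + 1) * s"
        by (simp add: A1_def A2_def g_def s_def algebra_simps)
      then have "X * A1 = X * A2 + (2 * x + g - 1) * (2 * x + g + 1) * s * ((x - real N) * (x + g))"
        by (simp add: X_def algebra_simps)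
      moreover have "B2 = B1 + (2 * x + g - 1) * s"
        by (simp add: B1_def B2_def g_def s_def algebra_simps)
      then have "Y * B2 = Y * B1 + Y * ((2 * x + g - 1) * s)"
        by (simp only: distrib_left)
      then have "Y * B2 = Y * B1 + (2 * x + g - 1) * (2 * x + g + 1) * s * (x * (x + c))"
        by (simp only: Y_def mult_ac)
      moreover have "(x - real N) * (x + g) - x * (x + c) = - real N * (2 * x + g)"
        by (simp add: g_def algebra_simps)
      then have "(2 * x + g - 1) * (2 * x + g + 1) * s * ((x - real N) * (x + g))
          - (2 * x + g - 1) * (2 * x + g + 1) * s * (x * (x + c)) = - (real N * s) * J"
        unfolding right_diff_distrib[symmetric] by (simp add: J_def)
      moreover have "L' = L - real N * s * J"
      proof -
        have "- ((real N - real m) * (real N + real m + a + b + 1))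
            = real m * (real m + a + b + 1) - real N * s"
          by (simp add: s_def algebra_simps)
        then show ?thesis unfolding L_def L'_def by (simp only: left_diff_distrib)
      qed
      ultimately show ?thesis unfolding E_def by simp
    qed
    have p_rec: "X * A1 * p (x + 1) = E * p x - Y * B1 * p (x - 1)"
    proof -
      have "X * A1 * (p (x + 1) - p x) - Y * B1 * (p x - p (x - 1)) = L * p x"
        using racah_poly_difference_equation[OF p_nz, of x]
        unfolding p_def[symmetric] X_def Y_def A1_def B1_def L_def J_def g_def add_diff_eq
        by (simp only: mult_ac)
      then show ?thesis by (simp add: E_def algebra_simps)
    qed
    have q_rec: "X * A2 * q (real N - (x + 1)) = E * q (real N - x) - Y * B2 * q (real N - (x - 1))"
    proof -
      define y where "y = real N - x"
      have y: "2 * y + - c - real N = - (2 * x + g)"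
        "- (2 * x + g) - 1 = - (2 * x + g + 1)" "- (2 * x + g) + 1 = - (2 * x + g - 1)"
        "y + (- a - real N - 1) + 1 = - (x + a)"
        "y + (- b - real N - 1) + - c + 1 = - (x + b + c)"
        "y - real N = - x" "y + - c = - (x + g)" "- (x + g) - real N = - (x + c)"
        "- (x + c) - (- a - real N - 1) - 1 = - (x + g - a)"
        "- x - (- b - real N - 1) - 1 = - (x - real N - b)"
        by (simp_all add: y_def g_def)
      have s: "real M * (real M + (- a - real N - 1) + (- b - real N - 1) + 1)
          = - ((real N - real m) * (real N + real m + a + b + 1))"
        unfolding M(1) mult_minus_right[symmetric] by (rule arg_cong[where f = "(*) _"]) simp
      have "- (2 * x + g + 1) * (- (x + a) * - (x + b + c) * - x * - (x + c)) * (q (y + 1) - q y)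
          - - (2 * x + g - 1) * (y * - (x + g) * - (x + g - a) * - (x - real N - b)) * (q y - q (y - 1))
          = - ((real N - real m) * (real N + real m + a + b + 1)) *
            (- (2 * x + g + 1) * - (2 * x + g) * - (2 * x + g - 1)) * q y"
        using racah_poly_difference_equation[OF q_nz, of y, folded q_def] unfolding s y .
      moreover have "- (2 * x + g + 1) * (- (x + a) * - (x + b + c) * - x * - (x + c)) = - (Y * B2)"
        by (simp only: Y_def B2_def mult_minus_left mult_minus_right minus_minus mult_ac)
      moreover have "- (2 * x + g - 1) * (y * - (x + g) * - (x + g - a) * - (x - real N - b)) = - (X * A2)"
      proof -
        have "y = - (x - real N)" by (simp add: y_def)
        then show ?thesis by (simp only: X_def A2_def mult_minus_left mult_minus_right minus_minus mult_ac)
      qed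
      moreover have "- ((real N - real m) * (real N + real m + a + b + 1)) *
            (- (2 * x + g + 1) * - (2 * x + g) * - (2 * x + g - 1)) = - L'"
        by (simp only: L'_def J_def mult_minus_left mult_minus_right minus_minus mult_ac)
      ultimately have "- (Y * B2) * (q (y + 1) - q y) - - (X * A2) * (q y - q (y - 1)) = - L' * q y"
        by simp
      moreover have "y + 1 = real N - (x - 1)" "y - 1 = real N - (x + 1)"
        by (simp_all add: y_def)
      ultimately show ?thesis unfolding E' y_def by (simp add: algebra_simps)
    qed
    define A0 B0 C0 D0 where "A0 = pochhammer (c - a - real N) n"
      and "B0 = pochhammer (- real N - b) n" and "C0 = pochhammer (b + c + 1) n" and "D0 = pochhammer (a + 1) n"
    have xs: "real n = x - 1" "real (Suc n) = x" "real (Suc (Suc n)) = x + 1" by (auto simp: x_def)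
    have arg: "c - a - real N + (x - 1) = x + g - a - 1" "c - a - real N + x = x + g - a"
      "- real N - b + (x - 1) = x - real N - b - 1" "- real N - b + x = x - real N - b"
      "b + c + 1 + (x - 1) = x + b + c" "b + c + 1 + x = x + b + c + 1"
      "a + 1 + (x - 1) = x + a" "a + 1 + x = x + a + 1"
      by (simp_all add: g_def)
    \<comment> \<open>The gauge factors contribute \<open>B1\<close>, \<open>A2\<close> on the left and \<open>B2\<close>, \<open>A1\<close> on the right, which makes
      the two recurrences identical.\<close>
    have F: "F n = A0 * B0 * K1 * q (real N - (x - 1))"
       "F (Suc n) = A0 * B0 * B1 * K1 * q (real N - x)"
       "F (Suc (Suc n)) = A0 * B0 * B1 * A2 * K1 * q (real N - (x + 1))"
      unfolding F_def pochhammer_Suc xs arg A0_def B0_def B1_def A2_def by (simp_all only: mult_ac)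
    have H: "H n = C0 * D0 * K2 * p (x - 1)"
       "H (Suc n) = C0 * D0 * B2 * K2 * p x"
       "H (Suc (Suc n)) = C0 * D0 * B2 * A1 * K2 * p (x + 1)"
      unfolding H_def pochhammer_Suc xs arg C0_def D0_def B2_def A1_def by (simp_all only: mult_ac)
    have "X * F (Suc (Suc n)) = A0 * B0 * B1 * K1 * (X * A2 * q (real N - (x + 1)))"
      unfolding F by (simp only: mult_ac)
    also have "\<dots> = E * F (Suc n) - Y * B2 * B1 * F n"
      unfolding F q_rec by (simp add: algebra_simps)
    finally have "X * F (Suc (Suc n)) = E * F (Suc n) - Y * B2 * B1 * F n" .
    moreover have "X * H (Suc (Suc n)) = C0 * D0 * B2 * K2 * (X * A1 * p (x + 1))"
      unfolding H by (simp only: mult_ac)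
    then have "X * H (Suc (Suc n)) = E * H (Suc n) - Y * B2 * B1 * H n"
      unfolding H p_rec by (simp add: algebra_simps)
    ultimately have "X * F (Suc (Suc n)) = X * H (Suc (Suc n))" using that by simp
    moreover have "X \<noteq> 0"
    proof -
      have "2 * x + g - 1 = real (Suc (2 * n)) - real N + c" "x + g = real (Suc n) - real N + c"
        by (simp_all add: x_def g_def)
      moreover have "x - real N \<noteq> 0" using that(3) by (simp add: x_def)
      ultimately show ?thesis
        using G[of "Suc n"] G[of "Suc (2 * n)"] that(3) unfolding X_def by simp
    qed
    ultimately show ?thesis by simp
  qed
  have "F n = H n \<and> (Suc n \<le> N \<longrightarrow> F (Suc n) = H (Suc n))" if "n \<le> N" for n
    using that by (induction n) (use F0 F1 step in auto)
  then have "F n = H n" using nN by blast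
  then show ?thesis by (simp add: F_def H_def K1_def K2_def p_def q_def M_def)
qed

section \<open>The scalar products as Racah polynomials\<close>

lemma racah_poly_extend:
  assumes "i \<le> N"
  shows "racah_poly i a b c \<nu> x = (\<Sum>l\<le>N.
     pochhammer (- real i) l * pochhammer (real i + a + b + 1) l *
       (pochhammer (- x) l * pochhammer (x + c - \<nu>) l) /
     (pochhammer (a + 1) l * pochhammer (b + c + 1) l * pochhammer (- \<nu>) l * fact l))"
  unfolding racah_poly_def using assms
  by (intro sum.mono_neutral_left) (auto simp: pochhammer_of_nat_eq_0_iff)

text \<open>
  The terms with \<open>x < l \<le> i\<close> vanish through \<open>(-x)\<^sub>l = 0\<close>. This includes those with the denominator
  \<open>(-N)\<^sub>l = 0\<close>, as division by zero yields zero.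
\<close>

lemma racah_eq_racah_poly: "racah i x a b c N = racah_poly i a b c (real N) (real x)"
proof -
  have "racah_poly i a b c (real N) (real x) = (\<Sum>l = 0..min i x. pochhammer (- real i) l * pochhammer (real i + a + b + 1) l *
       (pochhammer (- real x) l * pochhammer (real x + c - real N) l) /
     (pochhammer (a + 1) l * pochhammer (b + c + 1) l * pochhammer (- real N) l * fact l))"
    unfolding racah_poly_def
    by (intro sum.mono_neutral_right) (auto simp: pochhammer_of_nat_eq_0_iff)
  then show ?thesis by (simp add: racah_def poch_def mult.assoc)
qed

lemma scalar_prod_smult_vec:
  fixes r t :: real
  shows "(r \<cdot>\<^sub>v vec (N + 1) f) \<bullet> (t \<cdot>\<^sub>v vec (N + 1) g) = r * t * (\<Sum>l\<le>N. f l * g l)"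
proof -
  have "vec (N + 1) f \<bullet> vec (N + 1) g = (\<Sum>l\<le>N. f l * g l)"
    unfolding scalar_prod_def by (auto simp: lessThan_Suc_atMost atLeast0LessThan intro!: sum.cong)
  then show ?thesis by simp
qed

theorem proposition4:
  fixes N :: nat and \<alpha> \<beta> \<zeta> \<rho> \<alpha>' \<beta>' \<gamma>' :: real
  assumes "N \<ge> 1"
    and "\<alpha>' = - \<beta> - \<rho> - 1"
    and "\<beta>' = - \<beta> + \<rho> - 2 * \<zeta> - 1"
    and "\<gamma>' = real N - 2 * \<alpha> - \<rho>"
    and "generic_params N \<alpha> \<beta> \<zeta> \<rho> \<alpha>' \<beta>' \<gamma>'"
  shows "\<forall>m\<le>N. \<forall>n\<le>N.
    S_fun N \<alpha> \<beta> \<zeta> \<rho> m n =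
      poch [\<alpha>' + 1] n * poch [- real N, \<beta>' + \<gamma>' + 1] m /
      (fact n * poch [real n - real N + \<gamma>'] n * poch [real m + \<alpha>' + \<beta>' + 1] m) *
      racah m n \<alpha>' \<beta>' \<gamma>' N \<and>
    S_tilde N \<alpha> \<beta> \<zeta> \<rho> m n =
      (-1) ^ N * poch [- real N, \<gamma>' - \<alpha>' - real N, - \<beta>' - real N] (N - m) *
      poch [\<alpha>' + 1] m * poch [- \<gamma>' - \<beta>' - real n] n /
      (poch [- real N - real m - \<alpha>' - \<beta>' - 1] (N - m) *
       poch [real n - real N, - \<gamma>' - real n] (N - n) *
       poch [\<gamma>' - \<alpha>' - real N, - real N - \<beta>'] n) *
      racah m n \<alpha>' \<beta>' \<gamma>' N"
proof (intro allI impI conjI)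
  fix m n assume mN: "m \<le> N" and nN: "n \<le> N"
  note gen = assms(5)[unfolded generic_params_def poch_def, rule_format, simplified]
  have params: "- \<beta> - \<rho> = \<alpha>' + 1" "\<beta> + \<rho> - real N + 1 = - \<alpha>' - real N"
    "2 * \<beta> + 2 * \<zeta> - real N - real k + 1 = - real N - real k - \<alpha>' - \<beta>' - 1"
    "real k - 2 * \<beta> - 2 * \<zeta> - 1 = real k + \<alpha>' + \<beta>' + 1"
    "real k - 2 * \<alpha> - \<rho> = real k + \<gamma>' - real N"
    "real N - 2 * \<alpha> - \<beta> - 2 * \<zeta> = \<beta>' + \<gamma>' + 1"
    "real k + real N - 2 * \<alpha> - \<beta> - 2 * \<zeta> = \<beta>' + \<gamma>' + 1 + real k"
    "2 * \<alpha> + \<rho> - real N - real k = - \<gamma>' - real k"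
    "2 * \<alpha> + \<beta> + 2 * \<zeta> - 2 * real N + 1 = - \<beta>' - \<gamma>' - real N" for k
    using assms(2-4) by simp_all
  show "S_fun N \<alpha> \<beta> \<zeta> \<rho> m n =
      poch [\<alpha>' + 1] n * poch [- real N, \<beta>' + \<gamma>' + 1] m /
      (fact n * poch [real n - real N + \<gamma>'] n * poch [real m + \<alpha>' + \<beta>' + 1] m) *
      racah m n \<alpha>' \<beta>' \<gamma>' N"
  proof -
    have sign: "(-1) ^ l * x * ((-1) ^ l * y) = x * (y :: real)" for l x y
      by (simp add: mult_ac flip: power_add mult_2)
    have "racah m n \<alpha>' \<beta>' \<gamma>' N =
      (\<Sum>l\<le>N. (-1) ^ l * (poch [- real n, real n + \<gamma>' - real N] l / poch [\<alpha>' + 1] l) *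
        ((-1) ^ l * (poch [- real m, real m + \<alpha>' + \<beta>' + 1] l /
         (fact l * poch [- real N, \<beta>' + \<gamma>' + 1] l))))"
      unfolding racah_eq_racah_poly racah_poly_extend[OF mN] sign
      by (simp add: poch_def mult_ac add_diff_eq diff_add_eq)
    then show ?thesis
      unfolding S_fun_def f_dual_def e_vec_def params scalar_prod_smult_vec
      by (simp add: diff_add_eq)
  qed
  have A: "pochhammer (\<alpha>' + 1) N \<noteq> 0" and B: "pochhammer (\<beta>' + \<gamma>' + 1) N \<noteq> 0"
    using gen[of N] by auto
  have G: "real j - real N + \<gamma>' \<noteq> 0" if j: "1 \<le> j" "j < 2 * N" for j
  proof -
    \<comment> \<open>\<open>(k - N + \<gamma>')\<^sub>k \<noteq> 0\<close> excludes the zeros \<open>j = k, \<dots>, 2 k - 1\<close>; for \<open>1 \<le> k \<le> N\<close> these ranges cover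
      \<open>1, \<dots>, 2 N - 1\<close>.\<close>
    define k where "k = (if j \<le> N then j else N)"
    have "k \<le> N" "j - k < k" "k \<le> j" using j by (auto simp: k_def)
    then have "real k - real N + \<gamma>' + real (j - k) \<noteq> 0"
      using gen[of k] by (auto simp: pochhammer_eq_0_iff)
    then show ?thesis using \<open>k \<le> j\<close> by (simp add: algebra_simps of_nat_diff)
  qed
  show "S_tilde N \<alpha> \<beta> \<zeta> \<rho> m n =
      (-1) ^ N * poch [- real N, \<gamma>' - \<alpha>' - real N, - \<beta>' - real N] (N - m) *
      poch [\<alpha>' + 1] m * poch [- \<gamma>' - \<beta>' - real n] n /
      (poch [- real N - real m - \<alpha>' - \<beta>' - 1] (N - m) *
       poch [real n - real N, - \<gamma>' - real n] (N - n) *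
       poch [\<gamma>' - \<alpha>' - real N, - real N - \<beta>'] n) *
      racah m n \<alpha>' \<beta>' \<gamma>' N"
  proof -
    define q where "q = racah_poly (N - m) (- \<alpha>' - real N - 1) (- \<beta>' - real N - 1) (- \<gamma>') (real N) (real N - real n)"
    define p where "p = racah_poly m \<alpha>' \<beta>' \<gamma>' (real N) (real n)"
    have args: "real (N - m) + (- \<alpha>' - real N - 1) + (- \<beta>' - real N - 1) + 1
        = - real N - real m - \<alpha>' - \<beta>' - 1"
      "- real (N - m) = real m - real N" "- (real N - real n) = real n - real N"
      "real N - real n + - \<gamma>' - real N = - \<gamma>' - real n"
      "- \<alpha>' - real N - 1 + 1 = - \<alpha>' - real N"
      "- \<beta>' - real N - 1 + - \<gamma>' + 1 = - \<beta>' - \<gamma>' - real N"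
      using mN by (simp_all add: of_nat_diff)
    have "q = (\<Sum>k\<le>N. poch [real n - real N, - \<gamma>' - real n] k / poch [- \<alpha>' - real N] k *
         (poch [real m - real N, - real N - real m - \<alpha>' - \<beta>' - 1] k /
          (fact k * poch [- real N, - \<beta>' - \<gamma>' - real N] k)))"
      unfolding q_def racah_poly_extend[OF diff_le_self] args poch_def
      by (simp add: mult_ac)
    also have "\<dots> = (\<Sum>l\<le>N. poch [real n - real N, - \<gamma>' - real n] (N - l) / poch [- \<alpha>' - real N] (N - l) *
         (poch [real m - real N, - real N - real m - \<alpha>' - \<beta>' - 1] (N - l) /
          (fact (N - l) * poch [- real N, - \<beta>' - \<gamma>' - real N] (N - l))))"
      unfolding atMost_atLeast0 by (subst sum.atLeastAtMost_rev) simp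
    finally have q: "(\<Sum>l\<le>N. poch [real n - real N, - \<gamma>' - real n] (N - l) / poch [- \<alpha>' - real N] (N - l) *
         (poch [real m - real N, - real N - real m - \<alpha>' - \<beta>' - 1] (N - l) /
          (fact (N - l) * poch [- real N, - \<beta>' - \<gamma>' - real N] (N - l)))) = q" ..
    define F1 F2 where "F1 = poch [real n - real N, - \<gamma>' - real n] (N - n)"
      and "F2 = poch [- real N - real m - \<alpha>' - \<beta>' - 1] (N - m)"
    define C1 C2 where "C1 = pochhammer (- \<alpha>' - real N) (N - n)"
      and "C2 = pochhammer (\<beta>' + \<gamma>' + 1 + real m) (N - m)"
    define P where "P = pochhammer (- real N) (N - m)"
    have St: "S_tilde N \<alpha> \<beta> \<zeta> \<rho> m n = C1 / F1 * (P * C2 / F2) * q"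
      unfolding S_tilde_def f_vec_def e_dual_def params scalar_prod_smult_vec q
      by (simp add: poch_def C1_def C2_def P_def F1_def F2_def)
    define AM BM An Bn where "AM = pochhammer (\<gamma>' - \<alpha>' - real N) (N - m)"
      and "BM = pochhammer (- real N - \<beta>') (N - m)"
      and "An = pochhammer (\<gamma>' - \<alpha>' - real N) n" and "Bn = pochhammer (- real N - \<beta>') n"
    \<comment> \<open>The reflection formula multiplied by \<open>(\<alpha>' + 1)\<^sub>m\<close>, with \<open>(\<alpha>' + 1)\<^sub>N\<close> split both at \<open>m\<close> and at \<open>n\<close> so that
      \<open>(\<alpha>' + 1)\<^sub>n\<close> cancels.\<close>
    have key: "C1 * C2 * (An * Bn) * q
       = (-1) ^ N * AM * BM * pochhammer (\<alpha>' + 1) m * pochhammer (- \<gamma>' - \<beta>' - real n) n * p"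
    proof -
      define D X Y where "D = pochhammer (\<alpha>' + 1) n"
        and "X = pochhammer (\<alpha>' + 1 + real m) (N - m)"
        and "Y = pochhammer (\<alpha>' + 1 + real n) (N - n)"
      have refl: "An * Bn * (C2 * X) * q = pochhammer (\<beta>' + \<gamma>' + 1) n * D * (AM * BM) * p"
        unfolding AM_def BM_def An_def Bn_def p_def q_def C2_def D_def X_def
        using mN nN A B G by (rule racah_poly_reflection)
      have split: "D * Y = pochhammer (\<alpha>' + 1) m * X"
        unfolding D_def X_def Y_def
        using pochhammer_product[OF mN, of "\<alpha>' + 1"] pochhammer_product[OF nN, of "\<alpha>' + 1"] by simp
      have Y: "C1 = (-1) ^ (N - n) * Y"
        unfolding C1_def Y_def
        using pochhammer_reflect[of "\<alpha>' + real n" "N - n"] nN by (simp add: of_nat_diff algebra_simps)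
      have Z: "pochhammer (- \<gamma>' - \<beta>' - real n) n = (-1) ^ n * pochhammer (\<beta>' + \<gamma>' + 1) n"
      proof -
        have "- \<gamma>' - \<beta>' - real n = - (\<beta>' + \<gamma>') - real n" by simp
        then show ?thesis by (simp only: pochhammer_reflect)
      qed
      have sign: "(-1) ^ (N - n) = (-1) ^ N * (-1 :: real) ^ n"
        using nN by (simp add: minus_one_power_iff)
      have "D * (C1 * C2 * (An * Bn) * q)
          = (-1) ^ N * (-1) ^ n * (D * Y) * C2 * (An * Bn) * q"
        unfolding Y sign by (simp only: mult_ac)
      also have "\<dots> = (-1) ^ N * (-1) ^ n * pochhammer (\<alpha>' + 1) m * (An * Bn * (C2 * X) * q)"
        unfolding split by (simp only: mult_ac)
      also have "\<dots> = D * ((-1) ^ N * AM * BM * pochhammer (\<alpha>' + 1) m *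
          pochhammer (- \<gamma>' - \<beta>' - real n) n * p)"
        unfolding refl Z by (simp only: mult_ac)
      finally show ?thesis
        using gen[of n] nN by (simp add: D_def)
    qed
    have nz: "An * Bn \<noteq> 0" using gen[of n] nN by (simp add: An_def Bn_def)
    have solved: "C1 * C2 * q = (-1) ^ N * AM * BM * pochhammer (\<alpha>' + 1) m *
          pochhammer (- \<gamma>' - \<beta>' - real n) n * p / (An * Bn)"
      unfolding nonzero_eq_divide_eq[OF nz] using key by (simp only: mult_ac)
    have regroup: "C1 / F1 * (P * C2 / F2) * q = P / (F2 * F1) * (C1 * C2 * q)"
      by (simp add: mult_ac)
    have swap: "- \<beta>' - real N = - real N - \<beta>'" by simp
    have prefactors:
      "poch [- real N, \<gamma>' - \<alpha>' - real N, - \<beta>' - real N] (N - m) = P * AM * BM"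
      "poch [\<gamma>' - \<alpha>' - real N, - real N - \<beta>'] n = An * Bn"
      "poch [\<alpha>' + 1] m = pochhammer (\<alpha>' + 1) m"
      "poch [- \<gamma>' - \<beta>' - real n] n = pochhammer (- \<gamma>' - \<beta>' - real n) n"
      unfolding swap by (simp_all add: poch_def P_def AM_def BM_def An_def Bn_def)
    show ?thesis
      unfolding St regroup solved racah_eq_racah_poly prefactors F1_def[symmetric] F2_def[symmetric]
        p_def[symmetric]
      by (simp only: divide_inverse inverse_mult_distrib mult_ac)
  qed
qed

end
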